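(* Let $\alpha>0$, $dt>0$, $dx>0$. (a) For every integer $s\ge1$, the $s$-stage RKL1 method applied to the constant coefficient heat equation under periodic or homogeneous Neumann boundary condition is monotone if and only if $$\alpha\frac{dt}{dx^2}\le\frac{s^2+s}{4}.$$ (b) For every integer $s\ge2$, the $s$-stage RKL2 method applied to the constant coefficient heat equation under periodic or homogeneous Neumann boundary condition is monotone if and only if $$\alpha\frac{dt}{dx^2}\le\frac{s^2+s-2}{8}.$$
   Context: Setting: the heat equation $u_t=\alpha u_{xx}$ with constant $\alpha>0$ is discretized in space by central differences as $\frac{du}{dt}=\alpha Mu$, where $u\in\mathbb{R}^{\mathbb{Z}}$, $[Mu]_i=\frac{[u]_{i+1}-2[u]_i+[u]_{i-1}}{dx^2}$, $dx>0$ is the grid size and $dt>0$ the (super) timestep. Periodic boundary conditions are treated as the boundaryless problem on $\mathbb{Z}$ with repeated values, and homogeneous Neumann boundary conditions as the periodic problem on the reflected and doubled domain; thus the scheme under either boundary condition is the scheme on $\mathbb{R}^{\mathbb{Z}}$, and monotonicity refers to the scheme as a function of $u^t\in\mathbb{R}^{\mathbb{Z}}$. Let $P_s$ be the Legendre polynomial of degree $s$ (with $P_s(1)=1$); polynomials are evaluated at operators in the usual way, and $I$ is the identity. One step of the $s$-stage RKL1 method is $$u^{t+dt}=P_s\Big(I+\frac{2\,dt}{s^2+s}\,\alpha M\Big)u^t,$$ and one step of the $s$-stage RKL2 method ($s\ge2$) is $$u^{t+dt}=\Big[\Big(1-\frac{s^2+s-2}{2s(s+1)}\Big)I+\frac{s^2+s-2}{2s(s+1)}P_s\Big(I+\frac{4\,dt}{s^2+s-2}\,\alpha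 M\Big)\Big]u^t.$$ A one-step method $u_i^{t+dt}=\mathcal{H}(u^t;i)$ (where $\mathcal H(\cdot\,;i)$ depends on finitely many entries of $u^t\in\mathbb{R}^{\mathbb Z}$) is called monotone if $\frac{\partial \mathcal{H}}{\partial u_j^t}(u^t;i)\ge 0$ for all grid indices $i,j\in\mathbb{Z}$ (and all $u^t$). *)

theory Defs
  imports Complex_Main "HOL-Computational_Algebra.Polynomial"
begin

text \<open>Bonnet's recursion \<open>(n + 2) P\<^sub>n\<^sub>+\<^sub>2 = (2 n + 3) x P\<^sub>n\<^sub>+\<^sub>1 - (n + 1) P\<^sub>n\<close>.\<close>

fun legendre_poly :: "nat \<Rightarrow> real poly" where
  "legendre_poly 0 = 1"
| "legendre_poly (Suc 0) = [:0, 1:]"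
| "legendre_poly (Suc (Suc n)) =
     smult (1 / real (n + 2))
       (smult (real (2 * n + 3)) ([:0, 1:] * legendre_poly (Suc n))
        - smult (real (n + 1)) (legendre_poly n))"

lemma poly_legendre_poly_1: "poly (legendre_poly n) 1 = 1"
proof (induction n rule: legendre_poly.induct)
  case (3 n)
  have "poly (legendre_poly (Suc (Suc n))) 1 =
      1 / real (n + 2) * (real (2 * n + 3) - real (n + 1))"
    unfolding legendre_poly.simps(3) poly_smult poly_diff poly_mult 3 by simp
  also have "real (2 * n + 3) - real (n + 1) = real (n + 2)" by simp
  finally show ?case by simp
qed simp_all

lemma degree_legendre_poly_le: "degree (legendre_poly n) \<le> n"
proof (induction n rule: legendre_poly.induct)
  case (3 n)
  have "degree ([:0, 1:] * legendre_poly (Suc n)) \<le> Suc (Suc n)"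
    using degree_mult_le[of "[:0, 1:]" "legendre_poly (Suc n)"] 3(1) by simp
  moreover have "degree (legendre_poly n) \<le> Suc (Suc n)"
    using 3(2) by linarith
  ultimately show ?case
    unfolding legendre_poly.simps(3)
    by (meson degree_diff_le degree_smult_le order.trans)
qed simp_all

lemma coeff_legendre_poly_pos: "coeff (legendre_poly n) n > 0"
proof (induction n rule: legendre_poly.induct)
  case (3 n)
  have "coeff (legendre_poly n) (Suc (Suc n)) = 0"
    using degree_legendre_poly_le[of n] by (intro coeff_eq_0) simp
  then have "coeff (legendre_poly (Suc (Suc n))) (Suc (Suc n)) =
      1 / real (n + 2) * (real (2 * n + 3) * coeff (legendre_poly (Suc n)) (Suc n))"
    unfolding legendre_poly.simps(3) by simp
  also have "\<dots> > 0"
    using 3(1) by (intro mult_pos_pos divide_pos_pos) simp_all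
  finally show ?case .
qed simp_all

lemma degree_legendre_poly: "degree (legendre_poly n) = n"
proof (rule antisym[OF degree_legendre_poly_le])
  show "n \<le> degree (legendre_poly n)"
    using coeff_legendre_poly_pos[of n] by (intro le_degree) simp
qed

text \<open>
  Grid functions, i.e. elements of \<open>\<real>\<^sup>\<int>\<close>, have type \<^typ>\<open>int \<Rightarrow> real\<close>. Under
  periodic boundary conditions the values are repeated; homogeneous Neumann conditions are the
  periodic ones on the reflected and doubled domain. In both cases the scheme is the one on
  \<open>\<real>\<^sup>\<int>\<close> below.
\<close>

definition central_diff :: "real \<Rightarrow> (int \<Rightarrow> real) \<Rightarrow> (int \<Rightarrow> real)" where
  "central_diff dx u = (\<lambda>i. (u (i + 1) - 2 * u i + u (i - 1)) / dx\<^sup>2)"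

definition poly_op ::
  "real poly \<Rightarrow> ((int \<Rightarrow> real) \<Rightarrow> (int \<Rightarrow> real)) \<Rightarrow> (int \<Rightarrow> real) \<Rightarrow> (int \<Rightarrow> real)" where
  "poly_op p L u = (\<lambda>i. \<Sum>k\<le>degree p. coeff p k * (L ^^ k) u i)"

definition rkl1_step ::
  "real \<Rightarrow> real \<Rightarrow> real \<Rightarrow> nat \<Rightarrow> (int \<Rightarrow> real) \<Rightarrow> (int \<Rightarrow> real)" where
  "rkl1_step \<alpha> dt dx s =
     poly_op (legendre_poly s)
       (\<lambda>u i. u i + 2 * dt / ((real s)\<^sup>2 + real s) * (\<alpha> * central_diff dx u i))"

definition rkl2_weight :: "nat \<Rightarrow> real" where
  "rkl2_weight s = ((real s)\<^sup>2 + real s - 2) / (2 * real s * (real s + 1))"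

definition rkl2_step ::
  "real \<Rightarrow> real \<Rightarrow> real \<Rightarrow> nat \<Rightarrow> (int \<Rightarrow> real) \<Rightarrow> (int \<Rightarrow> real)" where
  "rkl2_step \<alpha> dt dx s u =
     (\<lambda>i. (1 - rkl2_weight s) * u i
        + rkl2_weight s *
          poly_op (legendre_poly s)
            (\<lambda>v j. v j + 4 * dt / ((real s)\<^sup>2 + real s - 2) * (\<alpha> * central_diff dx v j)) u i)"

text \<open>
  A one-step scheme \<open>H\<close> sends the grid function at time \<open>t\<close> to the one at time \<open>t + dt\<close>.
  Its partial derivative in the entry with index \<open>j\<close> is the derivative along the line
  \<open>x \<mapsto> u(j := x)\<close>; its existence is part of monotonicity.
\<close>

definition monotone_scheme :: "((int \<Rightarrow> real) \<Rightarrow> (int \<Rightarrow> real)) \<Rightarrow> bool" where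
  "monotone_scheme H \<longleftrightarrow>
     (\<forall>u i j. \<exists>D. ((\<lambda>x. H (u(j := x)) i) has_real_derivative D) (at (u j)) \<and> D \<ge> 0)"

definition finite_stencil :: "((int \<Rightarrow> real) \<Rightarrow> (int \<Rightarrow> real)) \<Rightarrow> bool" where
  "finite_stencil H \<longleftrightarrow>
     (\<forall>i. \<exists>J. finite J \<and> (\<forall>u v. (\<forall>j\<in>J. u j = v j) \<longrightarrow> H u i = H v i))"

lemma finite_stencil_comp:
  assumes "finite_stencil G" "finite_stencil H"
  shows "finite_stencil (\<lambda>u. G (H u))"
  unfolding finite_stencil_def
proof
  fix i
  obtain J where J: "finite J" "\<And>u v. (\<forall>j\<in>J. u j = v j) \<Longrightarrow> G u i = G v i"
    using assms(1) unfolding finite_stencil_def by meson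
  obtain K where K: "\<And>i. finite (K i)"
    "\<And>i u v. (\<forall>j\<in>K i. u j = v j) \<Longrightarrow> H u i = H v i"
    using assms(2) unfolding finite_stencil_def by metis
  show "\<exists>J. finite J \<and> (\<forall>u v. (\<forall>j\<in>J. u j = v j) \<longrightarrow> G (H u) i = G (H v) i)"
    by (rule exI[of _ "\<Union>j\<in>J. K j"]) (auto intro!: J K)
qed

lemma finite_stencil_funpow:
  assumes "finite_stencil L"
  shows "finite_stencil (L ^^ k)"
proof (induction k)
  case 0
  have "\<exists>J. finite J \<and> (\<forall>u v. (\<forall>j\<in>J. u j = v j) \<longrightarrow> u i = v i)"
    for i :: int by (rule exI[of _ "{i}"]) simp
  then show ?case unfolding finite_stencil_def funpow_0 by blast
next
  case (Suc k)
  then show ?case using finite_stencil_comp[OF assms] by (simp add: o_def)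
qed

lemma finite_stencil_poly_op:
  assumes "finite_stencil L"
  shows "finite_stencil (poly_op p L)"
  unfolding finite_stencil_def
proof
  fix i
  have "\<forall>k. \<exists>J. finite J \<and> (\<forall>u v. (\<forall>j\<in>J. u j = v j) \<longrightarrow> (L ^^ k) u i = (L ^^ k) v i)"
    using finite_stencil_funpow[OF assms] unfolding finite_stencil_def by blast
  then obtain K where K: "\<And>k. finite (K k)"
    "\<And>k u v. (\<forall>j\<in>K k. u j = v j) \<Longrightarrow> (L ^^ k) u i = (L ^^ k) v i"
    by metis
  have "poly_op p L u i = poly_op p L v i"
    if "\<forall>j\<in>(\<Union>k\<le>degree p. K k). u j = v j" for u v
    unfolding poly_op_def
  proof (rule sum.cong[OF refl])
    fix k assume "k \<in> {..degree p}"
    then have "(L ^^ k) u i = (L ^^ k) v i" using that by (intro K) auto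
    then show "coeff p k * (L ^^ k) u i = coeff p k * (L ^^ k) v i" by simp
  qed
  then show "\<exists>J. finite J \<and> (\<forall>u v. (\<forall>j\<in>J. u j = v j) \<longrightarrow> poly_op p L u i = poly_op p L v i)"
    using K(1) by (intro exI[of _ "\<Union>k\<le>degree p. K k"]) auto
qed

lemma finite_stencil_euler:
  "finite_stencil (\<lambda>u i. u i + c * (\<alpha> * central_diff dx u i))"
  unfolding finite_stencil_def
proof
  fix i
  show "\<exists>J. finite J \<and> (\<forall>u v. (\<forall>j\<in>J. u j = v j) \<longrightarrow>
      u i + c * (\<alpha> * central_diff dx u i) = v i + c * (\<alpha> * central_diff dx v i))"
    by (rule exI[of _ "{i - 1, i, i + 1}"]) (simp add: central_diff_def)
qed

lemma finite_stencil_rkl1_step: "finite_stencil (rkl1_step \<alpha> dt dx s)"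
  unfolding rkl1_step_def by (intro finite_stencil_poly_op finite_stencil_euler)

lemma finite_stencil_combination:
  assumes "finite_stencil G"
  shows "finite_stencil (\<lambda>u i. a * u i + b * G u i)"
  unfolding finite_stencil_def
proof
  fix i
  obtain J where J: "finite J" "\<And>u v. (\<forall>j\<in>J. u j = v j) \<Longrightarrow> G u i = G v i"
    using assms unfolding finite_stencil_def by meson
  have "a * u i + b * G u i = a * v i + b * G v i"
    if "\<forall>j\<in>insert i J. u j = v j" for u v
    using that J(2)[of u v] by simp
  then show "\<exists>J. finite J \<and> (\<forall>u v. (\<forall>j\<in>J. u j = v j) \<longrightarrow>
      a * u i + b * G u i = a * v i + b * G v i)"
    using J(1) by (intro exI[of _ "insert i J"] conjI allI impI) (simp, blast)
qed

lemma finite_stencil_rkl2_step: "finite_stencil (rkl2_step \<alpha> dt dx s)"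
  unfolding rkl2_step_def
  by (intro finite_stencil_combination finite_stencil_poly_op finite_stencil_euler)

end

(*
  With a = 4 alpha dt / (dx^2 (s^2 + s)) for RKL1 (and its analogue for RKL2) the operator inside
  the Legendre polynomial is (1 - a) I + (a / 2) (S + S^-1), S being the shift, so its symbol is
  1 - a + a cos(phi). If a <= 1, put t^2 = 1 - a. By the addition theorem with both points on the
  latitude t,
    P_n(t^2 + (1 - t^2) cos(phi))
      = sum over integers m of (n-|m|)!/(n+|m|)! (1 - t^2)^|m| (P_n^(|m|)(t))^2 cos(m phi),
  so every stencil coefficient is a nonnegative multiple of a square. This expansion satisfies
  Bonnet's recursion, because the contiguous relations express all the derivatives involved
  through P_n^(m)(t) and P_n^(m+1)(t). If a > 1, the coefficient at offset s - 1 is a positive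
  multiple of 1 - a, hence negative; for RKL2 the identity part does not reach it, as s >= 2.
*)

theory Submission
  imports Defs
begin

section \<open>Derivatives of Legendre polynomials and their contiguous relations\<close>

declare legendre_poly.simps(3) [simp del]

definition legendre_deriv :: "nat \<Rightarrow> nat \<Rightarrow> real poly" where
  "legendre_deriv n m = (pderiv ^^ m) (legendre_poly n)"

lemma legendre_poly_bonnet:
  "real (n + 2) * poly (legendre_poly (n + 2)) x =
     real (2 * n + 3) * (x * poly (legendre_poly (n + 1)) x) - real (n + 1) * poly (legendre_poly n) x"
proof -
  have "poly (legendre_poly (Suc (Suc n))) x = 1 / real (n + 2) *
      (real (2 * n + 3) * (x * poly (legendre_poly (Suc n)) x) - real (n + 1) * poly (legendre_poly n) x)"
    unfolding legendre_poly.simps(3) by simp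
  then show ?thesis by simp
qed

lemma pderiv_legendre_poly_Suc_Suc:
  "real (n + 2) * poly (pderiv (legendre_poly (n + 2))) x =
     real (2 * n + 3) * (poly (legendre_poly (n + 1)) x + x * poly (pderiv (legendre_poly (n + 1))) x)
     - real (n + 1) * poly (pderiv (legendre_poly n)) x"
proof -
  have "poly (pderiv (legendre_poly (Suc (Suc n)))) x = 1 / real (n + 2) *
      (real (2 * n + 3) * (poly (legendre_poly (Suc n)) x + x * poly (pderiv (legendre_poly (Suc n))) x)
       - real (n + 1) * poly (pderiv (legendre_poly n)) x)"
    unfolding legendre_poly.simps(3)
    by (simp add: pderiv_smult pderiv_diff pderiv_mult pderiv_pCons algebra_simps)
  then show ?thesis by simp
qed

text \<open>One induction carries both relations, because each step needs both: at degree n they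
  yield \<open>3\<close> and \<open>4\<close>, which turn the differentiated Bonnet recursion and
  the recursion itself into the relations for the next degree.\<close>

lemma legendre_poly_pderiv:
  "poly (pderiv (legendre_poly (Suc n))) x =
     real (Suc n) * poly (legendre_poly n) x + x * poly (pderiv (legendre_poly n)) x"
  "real (Suc n) * poly (legendre_poly (Suc n)) x =
     real (Suc n) * x * poly (legendre_poly n) x - (1 - x\<^sup>2) * poly (pderiv (legendre_poly n)) x"
proof (induction n)
  case 0
  { case 1 show ?case by (simp add: pderiv_pCons) }
  { case 2 show ?case by simp }
next
  case (Suc n)
  let ?P = "\<lambda>k. poly (legendre_poly k) x" and ?D = "\<lambda>k. poly (pderiv (legendre_poly k)) x"
  have B: "(real n + 2) * ?P (Suc (Suc n)) = (2 * real n + 3) * (x * ?P (Suc n)) - (real n + 1) * ?P n"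
    using legendre_poly_bonnet[of n x] by (simp add: add.commute)
  have B': "(real n + 2) * ?D (Suc (Suc n)) =
      (2 * real n + 3) * (?P (Suc n) + x * ?D (Suc n)) - (real n + 1) * ?D n"
    using pderiv_legendre_poly_Suc_Suc[of n x] by (simp add: add.commute)
  have 1: "?D (Suc n) = (1 + real n) * ?P n + x * ?D n"
    and 2: "(1 + real n) * ?P (Suc n) = (1 + real n) * x * ?P n - (1 - x\<^sup>2) * ?D n"
    using Suc by simp_all
  have 3: "x * ?D (Suc n) - ?D n = (1 + real n) * ?P (Suc n)"
    unfolding 1 2 by (simp add: algebra_simps power2_eq_square)
  have 4: "(1 - x\<^sup>2) * ?D (Suc n) = (1 + real n) * (?P n - x * ?P (Suc n))"
  proof -
    have "(1 - x\<^sup>2) * ?D (Suc n) =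
        (1 - x\<^sup>2) * (1 + real n) * ?P n + x * ((1 + real n) * x * ?P n - (1 + real n) * ?P (Suc n))"
      unfolding 1 2 by (simp add: algebra_simps)
    then show ?thesis by (simp add: algebra_simps power2_eq_square)
  qed
  { case 1
    \<comment> \<open>Regrouping isolates the combination in \<open>3\<close>, which removes the
      derivative of degree n.\<close>
    have "(real n + 2) * ?D (Suc (Suc n)) = (2 * real n + 3) * ?P (Suc n)
        + (real n + 2) * (x * ?D (Suc n)) + (real n + 1) * (x * ?D (Suc n) - ?D n)"
      unfolding B' by (simp add: algebra_simps)
    also have "\<dots> = (real n + 2) * ((real n + 2) * ?P (Suc n) + x * ?D (Suc n))"
      unfolding 3 by (simp add: algebra_simps)
    finally have "?D (Suc (Suc n)) = (real n + 2) * ?P (Suc n) + x * ?D (Suc n)"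
      by (simp only: mult_cancel_left) simp
    then show ?case by (simp add: add.commute) }
  { case 2
    have "(real n + 2) * ?P (Suc (Suc n)) = (real n + 2) * x * ?P (Suc n) - (1 - x\<^sup>2) * ?D (Suc n)"
      unfolding B 4 by (simp add: algebra_simps)
    then show ?case by (simp add: algebra_simps) }
qed

lemma legendre_deriv_Suc: "legendre_deriv n (Suc m) = pderiv (legendre_deriv n m)"
  by (simp add: legendre_deriv_def)

text \<open>This is the first relation of \<open>legendre_poly_pderiv\<close> differentiated m
  times. Each differentiation of the factor x releases one more copy of the other factor, hence the
  coefficient n + m + 1.\<close>

lemma legendre_deriv_Suc_Suc:
  "legendre_deriv (Suc n) (Suc m) =
     smult (real (n + m + 1)) (legendre_deriv n m) + [:0, 1:] * legendre_deriv n (Suc m)"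
proof (induction m)
  case 0
  show ?case
    by (rule poly_ext) (simp add: legendre_deriv_def legendre_poly_pderiv(1) add.commute)
next
  case (Suc m)
  have "legendre_deriv (Suc n) (Suc (Suc m)) = pderiv (legendre_deriv (Suc n) (Suc m))"
    by (rule legendre_deriv_Suc)
  also have "\<dots> = smult (real (n + m + 1)) (legendre_deriv n (Suc m))
      + (legendre_deriv n (Suc m) + [:0, 1:] * legendre_deriv n (Suc (Suc m)))"
    unfolding Suc by (simp add: legendre_deriv_Suc pderiv_add pderiv_smult pderiv_mult pderiv_pCons)
  also have "\<dots> = smult (real (n + Suc m + 1)) (legendre_deriv n (Suc m))
      + [:0, 1:] * legendre_deriv n (Suc (Suc m))"
    by (rule poly_ext) (simp add: algebra_simps)
  finally show ?case .
qed

text \<open>Induction by differentiation, starting from the second relation of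
  \<open>legendre_poly_pderiv\<close>. The factor on the left is a difference of reals, so nothing
  is truncated for m > n.\<close>

lemma legendre_deriv_raise_poly:
  "smult (real n - real m + 1) (legendre_deriv (Suc n) m) =
     smult (real (n + m + 1)) ([:0, 1:] * legendre_deriv n m) - [:1, 0, -1:] * legendre_deriv n (Suc m)"
proof (induction m)
  case 0
  show ?case
    by (rule poly_ext)
      (use legendre_poly_pderiv(2) in \<open>simp add: legendre_deriv_def algebra_simps power2_eq_square\<close>)
next
  case (Suc m)
  have "pderiv (smult (real n - real m + 1) (legendre_deriv (Suc n) m)) =
    pderiv (smult (real (n + m + 1)) ([:0, 1:] * legendre_deriv n m) - [:1, 0, -1:] * legendre_deriv n (Suc m))"
    by (simp only: Suc)
  then have "poly (smult (real n - real m + 1) (legendre_deriv (Suc n) (Suc m))) x =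
      poly (smult (real (n + m + 1)) (legendre_deriv n m + [:0, 1:] * legendre_deriv n (Suc m))
        - ([:0, -2:] * legendre_deriv n (Suc m) + [:1, 0, -1:] * legendre_deriv n (Suc (Suc m)))) x" for x
    by (simp only: legendre_deriv_Suc pderiv_diff pderiv_smult pderiv_mult)
      (simp add: pderiv_pCons algebra_simps)
  \<comment> \<open>Subtracting this from the differentiated hypothesis lowers the left factor from
    n - m + 1 to n - m and cancels the derivative of order m.\<close>
  moreover have "poly (legendre_deriv (Suc n) (Suc m)) x =
      poly (smult (real (n + m + 1)) (legendre_deriv n m) + [:0, 1:] * legendre_deriv n (Suc m)) x" for x
    by (simp only: legendre_deriv_Suc_Suc)
  ultimately show ?case
    by (intro poly_ext) (simp add: algebra_simps)
qed

lemma legendre_deriv_raise: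
  "(real n - real m + 1) * poly (legendre_deriv (Suc n) m) t =
     (real n + real m + 1) * (t * poly (legendre_deriv n m) t)
     - (1 - t\<^sup>2) * poly (legendre_deriv n (Suc m)) t"
  using arg_cong[OF legendre_deriv_raise_poly[of n m], of "\<lambda>p. poly p t"]
  by (simp add: algebra_simps power2_eq_square)

lemma legendre_deriv_Suc_Suc_poly:
  "poly (legendre_deriv (Suc n) (Suc m)) t =
     (real n + real m + 1) * poly (legendre_deriv n m) t + t * poly (legendre_deriv n (Suc m)) t"
  by (simp add: legendre_deriv_Suc_Suc)

text \<open>Adding t times the raising relation to 1 - t^2 times
  \<open>legendre_deriv_Suc_Suc_poly\<close> cancels the derivative of order m + 1.\<close>

lemma legendre_deriv_lower:
  "(real n + real m + 1) * poly (legendre_deriv n m) t =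
     (1 - t\<^sup>2) * poly (legendre_deriv (Suc n) (Suc m)) t
     + (real n - real m + 1) * (t * poly (legendre_deriv (Suc n) m) t)"
  using legendre_deriv_raise[of n m t] legendre_deriv_Suc_Suc_poly[of n m t] by algebra

text \<open>Legendre's differential equation, differentiated m times. It arises by eliminating the
  derivative of degree n + 1 from two contiguous relations.\<close>

lemma legendre_deriv_ode:
  "(real n - real m) * (real n + real m + 1) * poly (legendre_deriv n m) t =
     2 * (real m + 1) * (t * poly (legendre_deriv n (Suc m)) t)
     - (1 - t\<^sup>2) * poly (legendre_deriv n (Suc (Suc m))) t"
proof -
  have "(real n - real m) * poly (legendre_deriv (Suc n) (Suc m)) t =
     (real n + real m + 2) * (t * poly (legendre_deriv n (Suc m)) t)
     - (1 - t\<^sup>2) * poly (legendre_deriv n (Suc (Suc m))) t"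
    using legendre_deriv_raise[of n "Suc m" t] by (simp add: algebra_simps)
  then show ?thesis using legendre_deriv_Suc_Suc_poly[of n m t] by algebra
qed

lemma legendre_deriv_eq_0:
  assumes "n < m"
  shows "legendre_deriv n m = 0"
proof -
  have "degree (legendre_deriv n m) = n - m" for m
    by (induction m) (simp_all add: legendre_deriv_def degree_legendre_poly degree_pderiv)
  \<comment> \<open>Beyond order n the truncated n - m says only that the degree is 0. Vanishing
    comes from differentiating the constant reached at order n.\<close>
  then obtain c where "legendre_deriv n n = [:c:]"
    by (metis degree_0_id diff_self_eq_0 degree_eq_zeroE)
  then have "legendre_deriv n (Suc (n + k)) = 0" for k
    by (induction k) (simp_all add: legendre_deriv_Suc pderiv_pCons)
  from this[of "m - Suc n"] show ?thesis using assms by simp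
qed

section \<open>Fourier coefficients from the addition theorem and their recursion in the
  degree\<close>

text \<open>For \<open>n < m\<close> the truncated \<open>n - m\<close> is harmless, because the derivative vanishes.\<close>

definition legendre_fourier :: "real \<Rightarrow> nat \<Rightarrow> nat \<Rightarrow> real" where
  "legendre_fourier t n m =
     fact (n - m) / fact (n + m) * (1 - t\<^sup>2) ^ m * (poly (legendre_deriv n m) t)\<^sup>2"

lemma legendre_fourier_nonneg:
  assumes "t\<^sup>2 \<le> 1"
  shows "legendre_fourier t n m \<ge> 0"
  using assms by (simp add: legendre_fourier_def)

lemma legendre_fourier_eq_0: "n < m \<Longrightarrow> legendre_fourier t n m = 0"
  by (simp add: legendre_fourier_def legendre_deriv_eq_0)

text \<open>The constant Fourier mode of Bonnet's recursion for P_n(t^2 + (1 - t^2) cos(phi)).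
  Multiplication by cos(phi) averages the two neighbouring orders; here these are 1 and -1, with
  equal coefficients, so the factor 1/2 disappears.\<close>

lemma legendre_fourier_rec_0:
  "real (n + 2) * legendre_fourier t (n + 2) 0 =
     real (2 * n + 3) * (t\<^sup>2 * legendre_fourier t (n + 1) 0 + (1 - t\<^sup>2) * legendre_fourier t (n + 1) 1)
     - real (n + 1) * legendre_fourier t n 0"
proof -
  let ?D = "\<lambda>n m. poly (legendre_deriv n m) t"
  define N where "N = real n + 1"
  have N: "N > 0" by (simp add: N_def)
  \<comment> \<open>The derivatives needed at degrees n and n + 2 are linear in x and y, so the
    claim becomes a rational identity in N, x and y.\<close>
  define x where "x = t * ?D (Suc n) 0"
  define y where "y = (1 - t\<^sup>2) * ?D (Suc n) 1"
  have up: "?D (n + 2) 0 = ((N + 1) * x - y) / (N + 1)"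
    using legendre_deriv_raise[of "Suc n" 0 t] N by (simp add: N_def x_def y_def field_simps)
  have dn: "?D n 0 = (y + N * x) / N"
    using legendre_deriv_lower[of n 0 t] N by (simp add: N_def x_def y_def field_simps)
  have w: "fact n / fact (n + 2) = 1 / (N * (N + 1))"
    by (simp add: N_def divide_simps)
  have B1: "(1 - t\<^sup>2) * legendre_fourier t (n + 1) 1 = y\<^sup>2 / (N * (N + 1))"
    unfolding legendre_fourier_def y_def using w by (simp add: field_simps power2_eq_square)
  have "real (n + 2) * legendre_fourier t (n + 2) 0 = (N + 1) * (((N + 1) * x - y) / (N + 1))\<^sup>2"
    using up by (simp add: legendre_fourier_def N_def)
  also have "\<dots> = (2 * N + 1) * (x\<^sup>2 + y\<^sup>2 / (N * (N + 1))) - N * ((y + N * x) / N)\<^sup>2"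
    using N by (simp add: divide_simps) (simp add: power2_eq_square algebra_simps)
  also have "\<dots> = real (2 * n + 3) * (t\<^sup>2 * legendre_fourier t (n + 1) 0 + (1 - t\<^sup>2) * legendre_fourier t (n + 1) 1)
     - real (n + 1) * legendre_fourier t n 0"
    unfolding B1 using dn
    by (simp add: legendre_fourier_def N_def x_def power_mult_distrib add.commute)
  finally show ?thesis .
qed

text \<open>Mode m + 1 of the same recursion, whose neighbours are the orders m and m + 2. The cases
  m >= n are separate because there some of the terms vanish and the factorial weights would involve
  truncated differences.\<close>

lemma legendre_fourier_rec_Suc:
  "real (n + 2) * legendre_fourier t (n + 2) (Suc m) =
     real (2 * n + 3) * (t\<^sup>2 * legendre_fourier t (n + 1) (Suc m)
       + (1 - t\<^sup>2) / 2 * (legendre_fourier t (n + 1) m + legendre_fourier t (n + 1) (m + 2)))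
     - real (n + 1) * legendre_fourier t n (Suc m)"
proof -
  let ?D = "\<lambda>n m. poly (legendre_deriv n m) t"
  consider "m > n + 1" | "m = n + 1" | "m = n" | "m < n" by linarith
  then show ?thesis
  proof cases
    case 1
    then show ?thesis by (simp add: legendre_fourier_eq_0)
  next
    case 2
    define e where "e = ?D (n + 1) (n + 1)"
    define F :: real where "F = fact (n + 1 + (n + 1))"
    have F: "F > 0" by (simp add: F_def)
    have "?D (n + 2) (n + 2) = (2 * real n + 3) * e"
      using legendre_deriv_Suc_Suc_poly[of "Suc n" "Suc n" t] by (simp add: legendre_deriv_eq_0 e_def)
    moreover have "fact (n + 2 + (n + 2)) = (2 * real n + 4) * (2 * real n + 3) * F"
      by (simp add: F_def algebra_simps)
    ultimately have B2: "legendre_fourier t (n + 2) (n + 2) =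
        1 / ((2 * real n + 4) * (2 * real n + 3) * F) * (1 - t\<^sup>2) ^ (n + 2) * ((2 * real n + 3) * e)\<^sup>2"
      by (simp only: legendre_fourier_def) simp
    have B1: "legendre_fourier t (n + 1) (n + 1) = 1 / F * (1 - t\<^sup>2) ^ (n + 1) * e\<^sup>2"
      by (simp only: legendre_fourier_def e_def F_def) simp
    have "real (n + 2) * legendre_fourier t (n + 2) (n + 2) =
       real (2 * n + 3) * ((1 - t\<^sup>2) / 2 * legendre_fourier t (n + 1) (n + 1))"
      unfolding B1 B2 using F
      by (simp add: divide_simps) (simp add: power2_eq_square algebra_simps)
    then show ?thesis using 2 by (simp add: legendre_fourier_eq_0)
  next
    case 3
    define e where "e = ?D (n + 1) (n + 1)"
    define F :: real where "F = fact (n + 1 + n)"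
    have F: "F > 0" by (simp add: F_def)
    have "?D (n + 2) (n + 1) = (2 * real n + 3) * (t * e)"
      using legendre_deriv_raise[of "Suc n" "Suc n" t] by (simp add: legendre_deriv_eq_0 e_def)
    moreover have "fact (n + 2 + (n + 1)) = (2 * real n + 3) * (2 * real n + 2) * F"
      by (simp add: F_def numeral_3_eq_3 algebra_simps)
    ultimately have B2: "legendre_fourier t (n + 2) (n + 1) =
        1 / ((2 * real n + 3) * (2 * real n + 2) * F) * (1 - t\<^sup>2) ^ (n + 1) * ((2 * real n + 3) * (t * e))\<^sup>2"
      by (simp only: legendre_fourier_def) simp
    have "fact (n + 1 + (n + 1)) = (2 * real n + 2) * F"
      by (simp add: F_def algebra_simps)
    then have B1: "legendre_fourier t (n + 1) (n + 1) = 1 / ((2 * real n + 2) * F) * (1 - t\<^sup>2) ^ (n + 1) * e\<^sup>2"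
      by (simp only: legendre_fourier_def e_def) simp
    \<comment> \<open>In the differentiated Legendre equation of degree n + 1 and order n, the term
      of order n + 2 vanishes.\<close>
    have "(2 * real n + 2) * ?D (n + 1) n = (2 * real n + 2) * (t * e)"
      using legendre_deriv_ode[of "Suc n" n t] by (simp add: legendre_deriv_eq_0 e_def algebra_simps)
    then have "?D (n + 1) n = t * e" by simp
    moreover have "fact (n + 1 + n) = F"
      by (simp add: F_def)
    ultimately have B0: "legendre_fourier t (n + 1) n = 1 / F * (1 - t\<^sup>2) ^ n * (t * e)\<^sup>2"
      by (simp only: legendre_fourier_def) simp
    have "real (n + 2) * legendre_fourier t (n + 2) (n + 1) =
       real (2 * n + 3) * (t\<^sup>2 * legendre_fourier t (n + 1) (n + 1)
       + (1 - t\<^sup>2) / 2 * legendre_fourier t (n + 1) n)"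
      unfolding B0 B1 B2 using F
      by (simp add: divide_simps) (simp add: power2_eq_square algebra_simps)
    then show ?thesis using 3 by (simp add: legendre_fourier_eq_0)
  next
    case 4
    \<comment> \<open>In these variables Bonnet's coefficients n + 1, n + 2 and 2 n + 3 are (k + l)
      / 2, (k + l) / 2 + 1 and k + l + 1.\<close>
    define k where "k = real n - real m"
    define l where "l = real n + real m + 2"
    have k: "k > 0" and l: "l > 0" using 4 by (simp_all add: k_def l_def)
    define x where "x = t * ?D (Suc n) (Suc m)"
    define y where "y = (1 - t\<^sup>2) * ?D (Suc n) (Suc (Suc m))"
    \<comment> \<open>The weight of degree n + 1 and order m + 2. The other four weights are
      polynomial multiples of it in k and l.\<close>
    define W :: real where "W = fact (n - Suc m) / fact (n + m + 3)"
    have up: "?D (n + 2) (Suc m) = ((l + 1) * x - y) / (k + 1)"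
      using legendre_deriv_raise[of "Suc n" "Suc m" t] k by (simp add: k_def l_def x_def y_def field_simps)
    have dn: "?D n (Suc m) = (y + k * x) / l"
      using legendre_deriv_lower[of n "Suc m" t] l by (simp add: k_def l_def x_def y_def field_simps)
    have "(k + 1) * l * ?D (n + 1) m = (l - k) * x - y"
      using legendre_deriv_ode[of "Suc n" m t] by (simp add: k_def l_def x_def y_def algebra_simps)
    then have lo: "?D (n + 1) m = ((l - k) * x - y) / ((k + 1) * l)"
      using l k by (simp add: eq_divide_eq mult.commute)
    \<comment> \<open>This substitution makes every natural subtraction inside the factorials
      explicit.\<close>
    obtain j where j: "n = m + j + 1" using 4 less_imp_Suc_add by fastforce
    have w1: "fact (n + 2 - Suc m) / fact (n + 2 + Suc m) = W * (k * (k + 1))"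
      and w2: "fact (n + 1 - Suc m) / fact (n + 1 + Suc m) = W * (k * (l + 1))"
      and w3: "fact (n + 1 - m) / fact (n + 1 + m) = W * (k * (k + 1) * l * (l + 1))"
      and w4: "fact (n + 1 - (m + 2)) / fact (n + 1 + (m + 2)) = W"
      and w5: "fact (n - Suc m) / fact (n + Suc m) = W * (l * (l + 1))"
      unfolding W_def k_def l_def j by (simp_all add: divide_simps numeral_3_eq_3)
    have "real (n + 2) * legendre_fourier t (n + 2) (Suc m) =
        W * (1 - t\<^sup>2) ^ Suc m * (((k + l) / 2 + 1) * (k * (k + 1)) * (((l + 1) * x - y) / (k + 1))\<^sup>2)"
      unfolding legendre_fourier_def w1 up by (simp add: k_def l_def)
    \<comment> \<open>With W and the power of 1 - t^2 factored out, a rational identity in k, l, x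
      and y remains.\<close>
    also have "((k + l) / 2 + 1) * (k * (k + 1)) * (((l + 1) * x - y) / (k + 1))\<^sup>2 =
        (k + l + 1) * (k * (l + 1) * x\<^sup>2
           + (k * (k + 1) * l * (l + 1) * (((l - k) * x - y) / ((k + 1) * l))\<^sup>2 + y\<^sup>2) / 2)
         - (k + l) / 2 * (l * (l + 1)) * ((y + k * x) / l)\<^sup>2"
      using k l by (simp add: divide_simps) (simp add: power2_eq_square algebra_simps)
    also have "W * (1 - t\<^sup>2) ^ Suc m * \<dots> = real (2 * n + 3) * (t\<^sup>2 * legendre_fourier t (n + 1) (Suc m)
       + (1 - t\<^sup>2) / 2 * (legendre_fourier t (n + 1) m + legendre_fourier t (n + 1) (m + 2)))
     - real (n + 1) * legendre_fourier t n (Suc m)"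
    proof -
      have distrib: "C * (A * (P + (Q + R) / 2) - N * E * Y) =
          A * (C * P + (C * Q + C * R) / 2) - N * (C * (E * Y))" for A C E N P Q R Y :: real
        by (simp add: algebra_simps)
      have e1: "k + l + 1 = real (2 * n + 3)" and e2: "(k + l) / 2 = real (n + 1)" by (simp_all add: k_def l_def)
      have e3: "W * (1 - t\<^sup>2) ^ Suc m * (k * (l + 1) * x\<^sup>2) = t\<^sup>2 * legendre_fourier t (n + 1) (Suc m)"
        unfolding legendre_fourier_def w2 x_def by (simp add: power_mult_distrib)
      have e4: "W * (1 - t\<^sup>2) ^ Suc m * (k * (k + 1) * l * (l + 1) * (((l - k) * x - y) / ((k + 1) * l))\<^sup>2)
          = (1 - t\<^sup>2) * legendre_fourier t (n + 1) m"
        unfolding legendre_fourier_def w3 lo by simp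
      have e5: "W * (1 - t\<^sup>2) ^ Suc m * y\<^sup>2 = (1 - t\<^sup>2) * legendre_fourier t (n + 1) (m + 2)"
        unfolding legendre_fourier_def w4 y_def by (simp add: power_mult_distrib power2_eq_square)
      have e6: "W * (1 - t\<^sup>2) ^ Suc m * ((l * (l + 1)) * ((y + k * x) / l)\<^sup>2) = legendre_fourier t n (Suc m)"
        unfolding legendre_fourier_def w5 dn by simp
      show ?thesis
        unfolding distrib e3 e4 e5 e6 e1 e2 by (simp add: distrib_left)
    qed
    finally show ?thesis .
  qed
qed

section \<open>Linear schemes and the sign of their stencil\<close>

definition linear_scheme :: "((int \<Rightarrow> real) \<Rightarrow> (int \<Rightarrow> real)) \<Rightarrow> bool" where
  "linear_scheme H \<longleftrightarrow> (\<forall>c d u v. H (\<lambda>i. c * u i + d * v i) = (\<lambda>i. c * H u i + d * H v i))"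

lemma linear_schemeD:
  "linear_scheme H \<Longrightarrow> H (\<lambda>i. c * u i + d * v i) i = c * H u i + d * H v i"
  by (simp add: linear_scheme_def)

lemma linear_scheme_0:
  assumes "linear_scheme H"
  shows "H (\<lambda>i. 0) = (\<lambda>i. 0)"
  using linear_schemeD[OF assms, of 0 "\<lambda>i. 0" 0 "\<lambda>i. 0"] by auto

lemma linear_scheme_sum:
  assumes "linear_scheme H" "finite A"
  shows "H (\<lambda>i. \<Sum>k\<in>A. c k * u k i) = (\<lambda>i. \<Sum>k\<in>A. c k * H (u k) i)"
  using assms(2)
proof induction
  case empty
  show ?case using linear_scheme_0[OF assms(1)] by simp
next
  case (insert k A)
  show ?case
    using linear_schemeD[OF assms(1), of "c k" "u k" 1 "\<lambda>i. \<Sum>k\<in>A. c k * u k i"] insert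
    by (simp add: fun_eq_iff)
qed

lemma linear_scheme_funpow:
  assumes "linear_scheme H"
  shows "linear_scheme (H ^^ k)"
  using assms by (induction k) (simp_all add: linear_scheme_def)

lemma linear_scheme_poly_op:
  assumes "linear_scheme L"
  shows "linear_scheme (poly_op p L)"
  unfolding linear_scheme_def poly_op_def
  by (simp add: linear_schemeD[OF linear_scheme_funpow[OF assms]] sum_distrib_left
      flip: sum.distrib) (simp add: algebra_simps)

definition delta :: "int \<Rightarrow> int \<Rightarrow> real" where
  "delta j i = (if i = j then 1 else 0)"

text \<open>Along the line \<open>u(j := x)\<close> a linear scheme is affine in x with slope
  \<open>H (delta j) i\<close>, so this slope is the unique partial derivative, whatever u
  is.\<close>

lemma monotone_scheme_linear:
  assumes "linear_scheme H"
  shows "monotone_scheme H \<longleftrightarrow> (\<forall>i j. H (delta j) i \<ge> 0)"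
proof -
  have "((\<lambda>x. H (u(j := x)) i) has_real_derivative H (delta j) i) (at (u j))" for u i j
  proof -
    have "H (u(j := x)) i = H u i + (x - u j) * H (delta j) i" for x
    proof -
      have "u(j := x) = (\<lambda>i. 1 * u i + (x - u j) * delta j i)"
        by (auto simp: delta_def)
      then show ?thesis using linear_schemeD[OF assms, of 1 u "x - u j" "delta j" i] by simp
    qed
    then show ?thesis by (auto intro!: derivative_eq_intros)
  qed
  then show ?thesis
    unfolding monotone_scheme_def by (metis DERIV_unique)
qed

section \<open>Polynomials evaluated at linear operators\<close>

text \<open>A common summation bound lets polynomials of different degree be combined, since the
  degree of a difference or a multiple may drop.\<close>

lemma poly_op_eq_sum:
  assumes "degree p \<le> N"
  shows "poly_op p L u i = (\<Sum>k\<le>N. coeff p k * (L ^^ k) u i)"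
  unfolding poly_op_def
  by (rule sum.mono_neutral_left) (use assms in \<open>auto simp: coeff_eq_0\<close>)

lemma poly_op_smult: "poly_op (smult c p) L u i = c * poly_op p L u i"
  using poly_op_eq_sum[of "smult c p" "degree p" L u i]
  by (simp add: degree_smult_le poly_op_def sum_distrib_left mult.assoc)

lemma poly_op_diff: "poly_op (p - q) L u i = poly_op p L u i - poly_op q L u i"
  using poly_op_eq_sum[of "p - q" "max (degree p) (degree q)" L u i]
    poly_op_eq_sum[of p "max (degree p) (degree q)" L u i]
    poly_op_eq_sum[of q "max (degree p) (degree q)" L u i]
  by (simp add: degree_diff_le_max left_diff_distrib sum_subtractf)

text \<open>Horner's rule: linearity pulls one application of L out of the sum, so multiplication by
  x becomes application of L.\<close>

lemma poly_op_pCons: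
  assumes "linear_scheme L"
  shows "poly_op (pCons c p) L u i = c * u i + L (poly_op p L u) i"
proof -
  have "poly_op (pCons c p) L u i = (\<Sum>k\<le>Suc (degree p). coeff (pCons c p) k * (L ^^ k) u i)"
    by (rule poly_op_eq_sum) (simp add: degree_pCons_le)
  also have "\<dots> = c * u i + (\<Sum>k\<le>degree p. coeff p k * L ((L ^^ k) u) i)"
    by (simp only: sum.atMost_Suc_shift) simp
  also have "(\<Sum>k\<le>degree p. coeff p k * L ((L ^^ k) u) i) = L (poly_op p L u) i"
    unfolding poly_op_def using linear_scheme_sum[OF assms, of "{..degree p}"] by simp
  finally show ?thesis .
qed

lemma poly_op_1: "poly_op 1 L u = u"
  by (simp add: poly_op_def)

lemma poly_op_legendre_bonnet:
  assumes "linear_scheme L"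
  shows "real (n + 2) * poly_op (legendre_poly (n + 2)) L u i =
     real (2 * n + 3) * L (poly_op (legendre_poly (n + 1)) L u) i
     - real (n + 1) * poly_op (legendre_poly n) L u i"
proof -
  have "poly_op (legendre_poly (Suc (Suc n))) L u i = 1 / real (n + 2) *
     (real (2 * n + 3) * L (poly_op (legendre_poly (Suc n)) L u) i
     - real (n + 1) * poly_op (legendre_poly n) L u i)"
    unfolding legendre_poly.simps(3) poly_op_smult poly_op_diff
    by (simp add: poly_op_pCons[OF assms] poly_op_smult)
  then show ?thesis by simp
qed

section \<open>Stencil coefficients of Legendre polynomials of the averaging operator\<close>

text \<open>The common form of the inner operators of both methods; \<open>euler_eq_avg_op\<close>
  gives the value of a.\<close>

definition avg_op :: "real \<Rightarrow> (int \<Rightarrow> real) \<Rightarrow> (int \<Rightarrow> real)" where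
  "avg_op a u i = (1 - a) * u i + a / 2 * (u (i + 1) + u (i - 1))"

lemma linear_scheme_avg_op: "linear_scheme (avg_op a)"
  by (simp add: linear_scheme_def avg_op_def fun_eq_iff algebra_simps)

lemma poly_op_legendre_avg_op_rec:
  "real (n + 2) * poly_op (legendre_poly (n + 2)) (avg_op a) u i =
     real (2 * n + 3) * ((1 - a) * poly_op (legendre_poly (n + 1)) (avg_op a) u i
       + a / 2 * (poly_op (legendre_poly (n + 1)) (avg_op a) u (i + 1)
         + poly_op (legendre_poly (n + 1)) (avg_op a) u (i - 1)))
     - real (n + 1) * poly_op (legendre_poly n) (avg_op a) u i"
  unfolding poly_op_legendre_bonnet[OF linear_scheme_avg_op]
    avg_op_def[of a "poly_op (legendre_poly (n + 1)) (avg_op a) u" i] by (rule refl)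

lemma poly_op_legendre_avg_op_1:
  "poly_op [:0, 1:] (avg_op a) u = avg_op a u"
  using poly_op_pCons[OF linear_scheme_avg_op, of 0 1 a u]
  by (simp add: fun_eq_iff poly_op_1 flip: one_pCons)

text \<open>Both sides obey the same three-term recursion in n, with t^2 = 1 - a and 1 - t^2 = a.
  The hypothesis makes the square root genuine.\<close>

lemma poly_op_legendre_delta:
  assumes "a \<le> 1"
  shows "poly_op (legendre_poly n) (avg_op a) (delta j) i =
    legendre_fourier (sqrt (1 - a)) n (nat \<bar>i - j\<bar>)"
proof (induction n arbitrary: i rule: legendre_poly.induct)
  case 1
  show ?case
    by (cases "i = j")
      (simp_all add: poly_op_1 delta_def legendre_fourier_eq_0, simp add: legendre_fourier_def legendre_deriv_def)
next
  case 2
  consider "i = j" | "i = j + 1" | "i = j - 1" | "nat \<bar>i - j\<bar> > 1" by linarith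
  then show ?case
    unfolding legendre_poly.simps(2) poly_op_legendre_avg_op_1
  proof cases
    case 4
    then show "avg_op a (delta j) i = legendre_fourier (sqrt (1 - a)) (Suc 0) (nat \<bar>i - j\<bar>)"
      by (auto simp: avg_op_def delta_def legendre_fourier_eq_0)
  qed (use assms in \<open>simp_all add: avg_op_def delta_def legendre_fourier_def legendre_deriv_def pderiv_pCons\<close>)
next
  case (3 n)
  define B where "B = legendre_fourier (sqrt (1 - a))"
  have t: "(sqrt (1 - a))\<^sup>2 = 1 - a" using assms by simp
  have "real (n + 2) * poly_op (legendre_poly (n + 2)) (avg_op a) (delta j) i =
     real (2 * n + 3) * ((1 - a) * B (n + 1) (nat \<bar>i - j\<bar>) +
       a / 2 * (B (n + 1) (nat \<bar>i + 1 - j\<bar>) + B (n + 1) (nat \<bar>i - 1 - j\<bar>)))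
     - real (n + 1) * B n (nat \<bar>i - j\<bar>)"
    unfolding poly_op_legendre_avg_op_rec using 3 by (simp add: B_def)
  also have "\<dots> = real (n + 2) * B (n + 2) (nat \<bar>i - j\<bar>)"
  proof (cases "i = j")
    \<comment> \<open>Both neighbours of j are at distance 1, so the two halves of a add up as in
      \<open>legendre_fourier_rec_0\<close>.\<close>
    case True
    then show ?thesis using legendre_fourier_rec_0[of n "sqrt (1 - a)"] unfolding t B_def[symmetric]
      by simp
  next
    case False
    define m where "m = nat \<bar>i - j\<bar> - 1"
    have m: "nat \<bar>i - j\<bar> = Suc m"
      using False by (simp add: m_def)
    \<comment> \<open>Which neighbour is nearer to j depends on the side on which i lies; the sum of
      the two does not.\<close>
    consider "nat \<bar>i + 1 - j\<bar> = m + 2" "nat \<bar>i - 1 - j\<bar> = m"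
      | "nat \<bar>i + 1 - j\<bar> = m" "nat \<bar>i - 1 - j\<bar> = m + 2"
      using m by linarith
    then have "B (n + 1) (nat \<bar>i + 1 - j\<bar>) + B (n + 1) (nat \<bar>i - 1 - j\<bar>) = B (n + 1) m + B (n + 1) (m + 2)"
      by cases (simp_all only: add.commute)
    then show ?thesis using legendre_fourier_rec_Suc[of n "sqrt (1 - a)" m]
      unfolding t B_def[symmetric] m by simp
  qed
  finally show ?case by (simp add: B_def)
qed

text \<open>Each step of the recursion widens the stencil by at most one cell. This discards the
  terms past the edge in the next lemma.\<close>

lemma poly_op_legendre_delta_support:
  assumes "i > int n"
  shows "poly_op (legendre_poly n) (avg_op a) (delta 0) i = 0"
  using assms
proof (induction n arbitrary: i rule: legendre_poly.induct)
  case 1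
  then show ?case by (simp add: poly_op_1 delta_def)
next
  case 2
  then show ?case
    unfolding legendre_poly.simps(2) poly_op_legendre_avg_op_1 by (simp add: avg_op_def delta_def)
next
  case (3 n)
  have "real (n + 2) * poly_op (legendre_poly (n + 2)) (avg_op a) (delta 0) i = 0"
    unfolding poly_op_legendre_avg_op_rec using 3 by simp
  then show ?case by simp
qed

text \<open>The two outermost coefficients are followed together. The edge one is multiplied by
  positive factors; the one next to it collects 1 - a < 0 times the previous edge value and a
  positive multiple of its own negative predecessor.\<close>

lemma poly_op_legendre_delta_edge:
  assumes "a > 1"
  shows "poly_op (legendre_poly (Suc n)) (avg_op a) (delta 0) (int n + 1) > 0"
    and "poly_op (legendre_poly (Suc n)) (avg_op a) (delta 0) (int n) < 0"
proof (induction n)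
  case 0
  { case 1
    show ?case using assms
      unfolding legendre_poly.simps(2) poly_op_legendre_avg_op_1 by (simp add: avg_op_def delta_def) }
  { case 2
    show ?case using assms
      unfolding legendre_poly.simps(2) poly_op_legendre_avg_op_1 by (simp add: avg_op_def delta_def) }
next
  case (Suc n)
  let ?V = "\<lambda>k. poly_op (legendre_poly k) (avg_op a) (delta 0)"
  have V0: "?V (Suc n) (int n + 2) = 0" "?V (Suc n) (int n + 3) = 0" "?V n (int n + 1) = 0" "?V n (int n + 2) = 0"
    by (simp_all add: poly_op_legendre_delta_support)
  { case 1
    have "real (n + 2) * ?V (n + 2) (int n + 2) = real (2 * n + 3) * (a / 2 * ?V (Suc n) (int n + 1))"
      unfolding poly_op_legendre_avg_op_rec using V0
      by (simp add: algebra_simps)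
    also have "\<dots> > 0" using assms Suc by simp
    finally show ?case by (simp add: zero_less_mult_iff add.commute) }
  { case 2
    have "real (n + 2) * ?V (n + 2) (int n + 1) =
        real (2 * n + 3) * ((1 - a) * ?V (Suc n) (int n + 1) + a / 2 * ?V (Suc n) (int n))"
      unfolding poly_op_legendre_avg_op_rec using V0
      by (simp add: algebra_simps)
    also have "\<dots> < 0"
      using assms Suc by (intro mult_pos_neg add_neg_neg mult_neg_pos) simp_all
    finally show ?case by (simp add: mult_less_0_iff add.commute) }
qed

section \<open>The monotonicity criterion and the time step bounds\<close>

text \<open>One criterion serves both methods: w = 1 is RKL1 and w = \<open>rkl2_weight s\<close> is
  RKL2.\<close>

lemma monotone_scheme_legendre:
  assumes "0 < w" "w \<le> 1" "w = 1 \<or> s \<ge> 2" "s \<ge> 1" "a \<ge> 0"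
  shows "monotone_scheme (\<lambda>u i. (1 - w) * u i + w * poly_op (legendre_poly s) (avg_op a) u i)
    \<longleftrightarrow> a \<le> 1"
proof -
  let ?H = "\<lambda>u i. (1 - w) * u i + w * poly_op (legendre_poly s) (avg_op a) u i"
  have "linear_scheme ?H"
    unfolding linear_scheme_def
    by (simp add: linear_schemeD[OF linear_scheme_poly_op[OF linear_scheme_avg_op]] fun_eq_iff algebra_simps)
  then have H: "monotone_scheme ?H \<longleftrightarrow> (\<forall>i j. ?H (delta j) i \<ge> 0)"
    by (rule monotone_scheme_linear)
  obtain n where n: "s = Suc n" using assms(4) by (cases s) auto
  show ?thesis
  proof (cases "a \<le> 1")
    case True
    then have "(1 - w) * delta j i \<ge> 0" "w * poly_op (legendre_poly s) (avg_op a) (delta j) i \<ge> 0" for i j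
      using assms(1,2,5)
      by (simp_all add: delta_def poly_op_legendre_delta legendre_fourier_nonneg)
    then show ?thesis using True unfolding H by (simp add: add_nonneg_nonneg)
  next
    case False
    then have "w * poly_op (legendre_poly s) (avg_op a) (delta 0) (int n) < 0"
      using poly_op_legendre_delta_edge(2)[of a n] assms(1) by (simp add: n mult_pos_neg)
    \<comment> \<open>Either 1 - w is 0, or the offset n = s - 1 is nonzero and the impulse vanishes
      there.\<close>
    moreover have "(1 - w) * delta 0 (int n) = 0"
      using assms(3) by (auto simp: n delta_def)
    ultimately have "?H (delta 0) (int n) < 0" by (simp only: add_0_left)
    then show ?thesis using False unfolding H by (auto simp: not_le)
  qed
qed

lemma euler_eq_avg_op:
  "(\<lambda>u i. u i + c * (\<alpha> * central_diff dx u i)) = avg_op (2 * c * \<alpha> / dx\<^sup>2)"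
  by (simp add: avg_op_def central_diff_def fun_eq_iff diff_divide_distrib add_divide_distrib algebra_simps)

text \<open>RKL1 takes k = 2, c = 4 and S = s^2 + s; RKL2 takes k = 4, c = 8 and S = s^2 + s -
  2.\<close>

lemma time_step_bound_iff:
  fixes S k c dt \<alpha> dx :: real
  assumes "S > 0" "k > 0" "c = 2 * k" "dx > 0"
  shows "2 * (k * dt / S) * \<alpha> / dx\<^sup>2 \<le> 1 \<longleftrightarrow> \<alpha> * (dt / dx\<^sup>2) \<le> S / c"
  using assms by (simp add: field_simps)

theorem theorem5p7:
  fixes \<alpha> dt dx :: real
  assumes "\<alpha> > 0" and "dt > 0" and "dx > 0"
  shows "(\<forall>s::nat. s \<ge> 1 \<longrightarrow>
            (monotone_scheme (rkl1_step \<alpha> dt dx s)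
               \<longleftrightarrow> \<alpha> * (dt / dx\<^sup>2) \<le> ((real s)\<^sup>2 + real s) / 4))
       \<and> (\<forall>s::nat. s \<ge> 2 \<longrightarrow>
            (monotone_scheme (rkl2_step \<alpha> dt dx s)
               \<longleftrightarrow> \<alpha> * (dt / dx\<^sup>2) \<le> ((real s)\<^sup>2 + real s - 2) / 8))"
proof (intro conjI allI impI)
  fix s :: nat
  assume s: "s \<ge> 1"
  have pos: "(real s)\<^sup>2 + real s > 0" using s by (simp add: add_nonneg_pos)
  have "monotone_scheme (rkl1_step \<alpha> dt dx s) \<longleftrightarrow>
      2 * (2 * dt / ((real s)\<^sup>2 + real s)) * \<alpha> / dx\<^sup>2 \<le> 1"
    unfolding rkl1_step_def euler_eq_avg_op
    using monotone_scheme_legendre[of 1 s "2 * (2 * dt / ((real s)\<^sup>2 + real s)) * \<alpha> / dx\<^sup>2"] s assms pos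
    by simp
  also have "\<dots> \<longleftrightarrow> \<alpha> * (dt / dx\<^sup>2) \<le> ((real s)\<^sup>2 + real s) / 4"
    using pos assms(3) by (intro time_step_bound_iff) simp_all
  finally show "monotone_scheme (rkl1_step \<alpha> dt dx s) \<longleftrightarrow> \<alpha> * (dt / dx\<^sup>2) \<le> ((real s)\<^sup>2 + real s) / 4" .
next
  fix s :: nat
  assume s: "s \<ge> 2"
  \<comment> \<open>The expression s^2 + s - 2 is 0 at s = 1; from s = 2 on it is positive, and so
    is the weight.\<close>
  have "(real s)\<^sup>2 \<ge> 2\<^sup>2" using s by (intro power_mono) simp_all
  then have pos: "(real s)\<^sup>2 + real s - 2 > 0" by simp
  have w: "0 < rkl2_weight s" "rkl2_weight s \<le> 1"
    using pos s by (simp_all add: rkl2_weight_def divide_simps power2_eq_square algebra_simps)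
  have "monotone_scheme (rkl2_step \<alpha> dt dx s) \<longleftrightarrow>
      2 * (4 * dt / ((real s)\<^sup>2 + real s - 2)) * \<alpha> / dx\<^sup>2 \<le> 1"
    unfolding rkl2_step_def euler_eq_avg_op
    using w s assms pos by (intro monotone_scheme_legendre) simp_all
  also have "\<dots> \<longleftrightarrow> \<alpha> * (dt / dx\<^sup>2) \<le> ((real s)\<^sup>2 + real s - 2) / 8"
    using pos assms(3) by (intro time_step_bound_iff) simp_all
  finally show "monotone_scheme (rkl2_step \<alpha> dt dx s) \<longleftrightarrow> \<alpha> * (dt / dx\<^sup>2) \<le> ((real s)\<^sup>2 + real s - 2) / 8" .
qed

end
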